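(* Let $\alpha\le 0$ and $\beta\ge 0$ be real numbers, and let $f\in\mathcal{A}$ satisfy $f(z)f'(z)/z\neq 0$ for all $z\in\mathbb{D}$. If at least one of the following inequalities holds for all $z\in\mathbb{D}$: (i) $\operatorname{Re}\left(\alpha\dfrac{Q_{SD}}{Q_{ST}}+Q_{ST}(1+\beta Q_{ST})\right)>0$; (ii) $\operatorname{Re}\left(\alpha\dfrac{Q_{SD}}{Q_{CV}}+Q_{ST}(1+\beta Q_{ST})\right)>0$; (iii) $\operatorname{Re}\left(\alpha\dfrac{Q_{SD}}{Q_{CV}}+Q_{CV}(1+\beta Q_{CV})\right)>0$; (iv) $\operatorname{Re}\left(\alpha\dfrac{Q_{SD}}{Q_{ST}}+Q_{CV}(1+\beta Q_{CV})\right)>0$; then $f$ is starlike.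
   Context: $\mathbb{D}=\{z\in\mathbb{C}:|z|<1\}$. $\mathcal{A}$ is the class of analytic functions $f:\mathbb{D}\to\mathbb{C}$ with $f(0)=0$ and $f'(0)=1$. For $f\in\mathcal{A}$, as functions of $z\in\mathbb{D}$: $Q_{ST}=zf'(z)/f(z)$ (with the removable singularity at $z=0$ filled in, value $1$), $Q_{CV}=1+zf''(z)/f'(z)$, and $Q_{SD}=z^2\Big(\big(f''(z)/f'(z)\big)'-\tfrac12\big(f''(z)/f'(z)\big)^2\Big)$ ($z^2$ times the Schwarzian derivative of $f$). The condition $f(z)f'(z)/z\neq0$ is understood at $z=0$ via the removable singularity (where the value is $1$). An inequality containing a quotient is understood to include the requirement that the denominators appearing in it do not vanish in $\mathbb{D}$. A function $f\in\mathcal{A}$ is starlike if $\operatorname{Re}Q_{ST}>0$ on $\mathbb{D}$; equivalently, $f$ is univalent and $tf(z)\in f(\mathbb{D})$ for all $z\in\mathbb{D}$, $t\in[0,1]$. *)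

theory Defs
  imports "HOL-Complex_Analysis.Complex_Analysis"
begin

definition class_A :: "(complex \<Rightarrow> complex) set" where
  "class_A = {f. f analytic_on ball 0 1 \<and> f 0 = 0 \<and> deriv f 0 = 1}"

text \<open>For \<open>f\<close> in \<open>class_A\<close> the singularities of \<open>z f'(z) / f(z)\<close> and of \<open>f(z) f'(z) / z\<close>
  at the origin are removable with value \<open>1\<close>; that value is filled in explicitly.\<close>

definition Q_ST :: "(complex \<Rightarrow> complex) \<Rightarrow> complex \<Rightarrow> complex" where
  "Q_ST f z = (if z = 0 then 1 else z * deriv f z / f z)"

definition f_deriv_quot :: "(complex \<Rightarrow> complex) \<Rightarrow> complex \<Rightarrow> complex" where
  "f_deriv_quot f z = (if z = 0 then 1 else f z * deriv f z / z)"

definition Q_CV :: "(complex \<Rightarrow> complex) \<Rightarrow> complex \<Rightarrow> complex" where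
  "Q_CV f z = 1 + z * deriv (deriv f) z / deriv f z"

definition schwarzian :: "(complex \<Rightarrow> complex) \<Rightarrow> complex \<Rightarrow> complex" where
  "schwarzian f z = deriv (\<lambda>w. deriv (deriv f) w / deriv f w) z
     - 1 / 2 * (deriv (deriv f) z / deriv f z)\<^sup>2"

definition Q_SD :: "(complex \<Rightarrow> complex) \<Rightarrow> complex \<Rightarrow> complex" where
  "Q_SD f z = z\<^sup>2 * schwarzian f z"

text \<open>Since \<open>x / 0 = 0\<close>, the condition \<open>Re (Q_ST f z) > 0\<close> for \<open>z \<noteq> 0\<close> already
  forces \<open>f z \<noteq> 0\<close>.\<close>

definition starlike_fun :: "(complex \<Rightarrow> complex) \<Rightarrow> bool" where
  "starlike_fun f \<longleftrightarrow> f \<in> class_A \<and> (\<forall>z\<in>ball 0 1. Re (Q_ST f z) > 0)"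

end

theory Submission
  imports Defs
begin

text \<open>
  Write \<open>p\<close> for \<open>Q\<^sub>S\<^sub>T\<close>; it is holomorphic on the disc with \<open>p(0) = 1\<close>, and starlikeness is
  \<open>Re p > 0\<close>. If that fails, there is a point \<open>z\<close> of least modulus where \<open>Re p\<close> vanishes.
  Moving out along the radius, \<open>Re p\<close> is positive before it reaches \<open>0\<close> at \<open>z\<close>; moving along the circle through
  \<open>z\<close>, it has a minimum there. So the first and second order conditions for these two
  one-variable problems say that \<open>z p'(z)\<close> is a real number \<open>\<sigma> \<le> 0\<close> and that
  \<open>Re (z p'(z) + z\<^sup>2 p''(z)) \<le> 0\<close> (\<open>derivatives_at_least_modulus_zero_of_Re\<close>).

  The other two quantities are differential expressions in \<open>p\<close>:
  \<open>Q\<^sub>C\<^sub>V = p + z p' / p\<close> and \<open>Q\<^sub>S\<^sub>D = z Q\<^sub>C\<^sub>V' + (1 - Q\<^sub>C\<^sub>V\<^sup>2) / 2\<close>. With \<open>p(z) = \<i>\<rho>\<close>, where \<open>\<rho> \<noteq> 0\<close>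
  because \<open>f'\<close> does not vanish, the first gives \<open>Q\<^sub>C\<^sub>V(z) = \<i>\<tau>\<close> with \<open>\<tau> = \<rho> - \<sigma> / \<rho>\<close> of the same
  sign as \<open>\<rho>\<close>, and the second gives \<open>Im Q\<^sub>S\<^sub>D(z) = - Re (z p' + z\<^sup>2 p'') / \<rho>\<close>, again of the
  sign of \<open>\<rho>\<close> or zero (\<open>boundary_values_if_not_starlike\<close>). Hence \<open>Q\<^sub>S\<^sub>D\<close> divided by \<open>\<i>\<rho>\<close> or \<open>\<i>\<tau>\<close>
  has nonnegative real part, while \<open>\<i>\<lambda> (1 + \<beta> \<i>\<lambda>)\<close> has real part \<open>- \<beta> \<lambda>\<^sup>2 \<le> 0\<close>. Since \<open>\<alpha> \<le> 0\<close>,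
  each of the four expressions has real part at most \<open>0\<close> at \<open>z\<close>, against the hypothesis.
\<close>

section \<open>Derivatives at the zero of least modulus of a real part\<close>

text \<open>The curves \<open>z exp(c t)\<close> are the circle through \<open>z\<close> for \<open>c = \<i>\<close> and the ray through \<open>z\<close>
  for \<open>c = 1\<close>, so that one formula serves both directions of motion.\<close>

lemma Re_along_exp_curve_has_derivative:
  fixes F :: "complex \<Rightarrow> complex" and c z :: complex and t :: real
  assumes "(F has_field_derivative D) (at (z * exp (c * of_real t)))"
  shows "((\<lambda>t. Re (F (z * exp (c * of_real t)))) has_real_derivative
            Re (c * (z * exp (c * of_real t)) * D)) (at t)"
proof -
  have "((\<lambda>w. z * exp (c * w)) has_field_derivative c * (z * exp (c * of_real t))) (at (of_real t))"
    by (auto intro!: derivative_eq_intros)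
  then have "((\<lambda>w. F (z * exp (c * w))) has_field_derivative D * (c * (z * exp (c * of_real t))))
      (at (of_real t))"
    using DERIV_chain2[where g = "\<lambda>w. z * exp (c * w)", OF assms] by blast
  then have "((\<lambda>t. F (z * exp (c * of_real t))) has_vector_derivative
      D * (c * (z * exp (c * of_real t)))) (at t)"
    by (rule has_vector_derivative_real_field)
  then show ?thesis
    unfolding has_real_derivative_iff_has_vector_derivative mult.commute[of D]
    by (rule bounded_linear.has_vector_derivative[OF bounded_linear_Re])
qed

text \<open>The necessary second order condition: were the second derivative negative, the first
  derivative would be negative just to the right of \<open>a\<close>, and \<open>\<phi>\<close> would fall below \<open>\<phi> a\<close>.\<close>

lemma second_derivative_nonneg_at_minimum:
  fixes \<phi> \<phi>' :: "real \<Rightarrow> real"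
  assumes deriv1: "\<And>t. (\<phi> has_real_derivative \<phi>' t) (at t)"
    and deriv2: "(\<phi>' has_real_derivative d) (at a)"
    and min: "\<And>t. \<phi> a \<le> \<phi> t"
  shows "\<phi>' a = 0" "0 \<le> d"
proof -
  show stationary: "\<phi>' a = 0"
    using DERIV_local_min[OF deriv1[of a], of 1] min by simp
  show "0 \<le> d"
  proof (rule ccontr)
    assume "\<not> 0 \<le> d"
    then obtain e where e: "e > 0" "\<And>h. 0 < h \<Longrightarrow> h < e \<Longrightarrow> \<phi>' (a + h) < \<phi>' a"
      using DERIV_neg_dec_right[OF deriv2] by auto
    have "\<phi> (a + e / 2) < \<phi> a"
    proof (rule DERIV_neg_imp_decreasing_open[of a "a + e / 2" \<phi>])
      show "a < a + e / 2" using e by simp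
      show "\<exists>y. (\<phi> has_real_derivative y) (at x) \<and> y < 0" if "a < x" "x < a + e / 2" for x
        using deriv1[of x] e(2)[of "x - a"] e(1) that stationary by auto
      show "continuous_on {a..a + e / 2} \<phi>"
        using deriv1 by (meson DERIV_isCont continuous_at_imp_continuous_on)
    qed
    then show False using min[of "a + e / 2"] by simp
  qed
qed

text \<open>A point of least modulus in \<open>{Re p \<le> 0}\<close> exists by compactness. \<open>Re p\<close> is positive on the open
  disc below it, so by continuity nonnegative on the closed disc, which forces \<open>Re p = 0\<close> at
  the point itself.\<close>

lemma least_modulus_zero_of_Re:
  fixes p :: "complex \<Rightarrow> complex"
  assumes cont: "continuous_on (ball 0 1) p" and pos: "Re (p 0) > 0"
    and ex: "z1 \<in> ball 0 1" "Re (p z1) \<le> 0"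
  obtains z where "z \<in> ball 0 1" "z \<noteq> 0" "Re (p z) = 0"
    "\<And>w. norm w \<le> norm z \<Longrightarrow> 0 \<le> Re (p w)"
proof -
  define K where "K = {w \<in> cball 0 (norm z1). Re (p w) \<le> 0}"
  have "cball 0 (norm z1) \<subseteq> ball 0 1"
    using ex(1) by auto
  then have "closed K"
    unfolding K_def
    by (intro continuous_on_closed_Collect_le continuous_intros continuous_on_subset[OF cont]) auto
  moreover have "bounded K"
    unfolding K_def by (rule bounded_subset[OF bounded_cball[of 0 "norm z1"]]) auto
  moreover have "z1 \<in> K"
    using ex by (simp add: K_def)
  ultimately obtain z where z: "z \<in> K" "\<And>w. w \<in> K \<Longrightarrow> norm z \<le> norm w"
    using continuous_attains_inf[of K norm]
    by (metis compact_eq_bounded_closed continuous_on_norm_id empty_iff)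
  have zin: "norm z < 1" "norm z \<le> norm z1" and zle: "Re (p z) \<le> 0"
    using z(1) ex(1) by (auto simp: K_def)
  have nz: "z \<noteq> 0"
    using zle pos by auto
  have inner: "0 \<le> Re (p w)" if "w \<in> ball 0 (norm z)" for w
    using z(2)[of w] zin that by (force simp: K_def)
  have clos: "closure (ball (0::complex) (norm z)) = cball 0 (norm z)"
    using nz by simp
  have "cball 0 (norm z) \<subseteq> ball 0 1"
    using zin by auto
  then have "continuous_on (closure (ball 0 (norm z))) (\<lambda>w. Re (p w))"
    unfolding clos by (intro continuous_intros continuous_on_subset[OF cont])
  then have nonneg: "0 \<le> Re (p w)" if "norm w \<le> norm z" for w
    by (rule continuous_ge_on_closure) (use inner that clos in auto)
  have "Re (p z) = 0"
    using zle nonneg[of z] by simp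
  then show ?thesis
    using that[of z] zin(1) nz nonneg by simp
qed

text \<open>The second order Miller--Mocanu lemma, with \<open>z p'(z)\<close> controlled by its sign. Stationarity of
  \<open>Re p\<close> on the circle through \<open>z\<close> makes \<open>z p'(z)\<close> real, the second order condition on the same
  circle gives the last inequality, and \<open>Re p \<ge> 0\<close> on the radius up to \<open>z\<close> gives
  the sign of \<open>z p'(z)\<close>.\<close>

lemma derivatives_at_least_modulus_zero_of_Re:
  fixes p :: "complex \<Rightarrow> complex"
  assumes hol: "p holomorphic_on ball 0 1" and pos: "Re (p 0) > 0"
    and ex: "z1 \<in> ball 0 1" "Re (p z1) \<le> 0"
  obtains z where "z \<in> ball 0 1" "z \<noteq> 0" "Re (p z) = 0"
    "Im (z * deriv p z) = 0" "Re (z * deriv p z) \<le> 0"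
    "Re (z * deriv p z + z\<^sup>2 * deriv (deriv p) z) \<le> 0"
proof -
  obtain z where z: "z \<in> ball 0 1" "z \<noteq> 0" "Re (p z) = 0"
    and nonneg: "\<And>w. norm w \<le> norm z \<Longrightarrow> 0 \<le> Re (p w)"
    using least_modulus_zero_of_Re[OF holomorphic_on_imp_continuous_on[OF hol] pos ex] by metis
  have D: "(p has_field_derivative deriv p w) (at w)"
    and DD: "(deriv p has_field_derivative deriv (deriv p) w) (at w)" if "w \<in> ball 0 1" for w
    using hol that by (auto intro!: holomorphic_derivI[of _ "ball 0 1"] holomorphic_deriv)

  \<comment> \<open>On the circle, \<open>d/dt\<close> acts on functions of \<open>w\<close> as \<open>\<i> w d/dw\<close>: applied once to \<open>p\<close> it
    yields a function with real part \<open>\<phi>'\<close>, applied twice it yields \<open>- (w p' + w\<^sup>2 p'')\<close>.\<close>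
  define \<phi> where "\<phi> t = Re (p (z * exp (\<i> * of_real t)))" for t
  define \<phi>' where "\<phi>' t = Re (\<i> * (z * exp (\<i> * of_real t) * deriv p (z * exp (\<i> * of_real t))))" for t
  have circle: "z * exp (\<i> * of_real t) \<in> ball 0 1" for t
    using z(1) by (simp add: norm_mult)
  have d1: "(\<phi> has_real_derivative \<phi>' t) (at t)" for t
    using Re_along_exp_curve_has_derivative[OF D[OF circle]]
    unfolding \<phi>_def \<phi>'_def by (simp add: mult.assoc)
  have "((\<lambda>w. \<i> * (w * deriv p w)) has_field_derivative \<i> * (deriv p z + z * deriv (deriv p) z)) (at z)"
    by (auto intro!: derivative_eq_intros DD z(1) simp: algebra_simps)
  then have "(\<phi>' has_real_derivative
      Re (\<i> * (z * exp (\<i> * of_real 0)) * (\<i> * (deriv p z + z * deriv (deriv p) z)))) (at 0)"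
    unfolding \<phi>'_def by (intro Re_along_exp_curve_has_derivative) simp
  moreover have "\<i> * (z * exp (\<i> * of_real 0)) * (\<i> * (deriv p z + z * deriv (deriv p) z))
      = - (z * deriv p z + z\<^sup>2 * deriv (deriv p) z)"
    by (simp add: algebra_simps power2_eq_square)
  ultimately have d2: "(\<phi>' has_real_derivative
      - Re (z * deriv p z + z\<^sup>2 * deriv (deriv p) z)) (at 0)"
    by (metis uminus_complex.sel(1))
  have minimum: "\<phi> 0 \<le> \<phi> t" for t
    using nonneg[of "z * exp (\<i> * of_real t)"] z(3) by (simp add: \<phi>_def norm_mult)
  have tangential: "Im (z * deriv p z) = 0"
    using second_derivative_nonneg_at_minimum(1)[OF d1 d2 minimum] by (simp add: \<phi>'_def)
  have second: "Re (z * deriv p z + z\<^sup>2 * deriv (deriv p) z) \<le> 0"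
    using second_derivative_nonneg_at_minimum(2)[OF d1 d2 minimum] by simp

  have radial: "Re (z * deriv p z) \<le> 0"
  proof (rule ccontr)
    assume "\<not> Re (z * deriv p z) \<le> 0"
    moreover have "((\<lambda>t. Re (p (z * exp (1 * of_real t)))) has_real_derivative
        Re (z * deriv p z)) (at 0)"
      using Re_along_exp_curve_has_derivative[of p _ z 1 0] D[OF z(1)] by simp
    ultimately obtain d where d: "d > 0"
      "\<forall>h>0. h < d \<longrightarrow>
        Re (p (z * exp (1 * of_real (0 - h)))) < Re (p (z * exp (1 * of_real 0)))"
      using DERIV_pos_inc_left[of "\<lambda>t. Re (p (z * exp (1 * of_real t)))" _ 0]
      unfolding not_le by blast
    from d(2) have less: "Re (p (z * exp (of_real (- (d / 2))))) < Re (p z)"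
      using d(1) by (auto dest!: spec[of _ "d / 2"])
    have "norm (z * exp (of_real (- (d / 2)))) = norm z * exp (- (d / 2))"
      by (simp only: norm_mult norm_exp_eq_Re Re_complex_of_real)
    also have "\<dots> \<le> norm z"
      using d(1) by (simp add: mult_left_le)
    finally have "0 \<le> Re (p (z * exp (of_real (- (d / 2)))))"
      by (rule nonneg)
    with less z(3) show False
      by linarith
  qed
  show ?thesis
    using that z tangential radial second by blast
qed

section \<open>Convexity quotient and Schwarzian in terms of the starlikeness quotient\<close>

text \<open>The point at issue is the origin. There \<open>f(z) / z\<close> extends holomorphically with value
  \<open>f'(0) = 1\<close>, and \<open>Q\<^sub>S\<^sub>T\<close> is \<open>f'\<close> divided by this zero-free extension.\<close>

lemma Q_ST_holomorphic:
  assumes A: "f \<in> class_A" and nz: "\<And>z. z \<in> ball 0 1 \<Longrightarrow> z \<noteq> 0 \<Longrightarrow> f z \<noteq> 0"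
  shows "Q_ST f holomorphic_on ball 0 1"
proof -
  have hol: "f holomorphic_on ball 0 1" and f0: "f 0 = 0" "deriv f 0 = 1"
    using A by (auto simp: class_A_def intro: analytic_imp_holomorphic)
  define g where "g z = (if z = 0 then deriv f 0 else (f z - f 0) / (z - 0))" for z
  have "g holomorphic_on ball 0 1"
    unfolding g_def using pole_lemma_open[OF hol open_ball, of 0] by simp
  moreover have "g z \<noteq> 0" if "z \<in> ball 0 1" for z
    using nz[OF that] f0 by (simp add: g_def)
  ultimately have "(\<lambda>z. deriv f z / g z) holomorphic_on ball 0 1"
    using hol by (auto intro!: holomorphic_intros)
  moreover have "deriv f z / g z = Q_ST f z" for z
    using f0 by (simp add: g_def Q_ST_def field_simps)
  ultimately show ?thesis by simp
qed

text \<open>Logarithmic differentiation of \<open>Q\<^sub>S\<^sub>T\<close>, carried out without logarithms or quotients: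
  differentiate \<open>w f'(w) = Q\<^sub>S\<^sub>T(w) f(w)\<close>, which holds on the whole disc, and divide by \<open>f'\<close>.\<close>

lemma Q_CV_eq:
  assumes A: "f \<in> class_A" and nz: "\<And>z. z \<in> ball 0 1 \<Longrightarrow> z \<noteq> 0 \<Longrightarrow> f z \<noteq> 0"
    and nz': "\<And>z. z \<in> ball 0 1 \<Longrightarrow> deriv f z \<noteq> 0" and z: "z \<in> ball 0 1"
  shows "Q_CV f z = Q_ST f z + z * deriv (Q_ST f) z / Q_ST f z"
proof (cases "z = 0")
  case True
  then show ?thesis by (simp add: Q_CV_def Q_ST_def)
next
  case False
  have hol: "f holomorphic_on ball 0 1" and f0: "f 0 = 0"
    using A by (auto simp: class_A_def intro: analytic_imp_holomorphic)
  note D [derivative_intros] = holomorphic_derivI[OF hol open_ball z]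
    holomorphic_derivI[OF holomorphic_deriv[OF hol open_ball] open_ball z]
    holomorphic_derivI[OF Q_ST_holomorphic[OF A nz] open_ball z]
  have eq: "w * deriv f w = Q_ST f w * f w" if "w \<in> ball 0 1" for w
    using nz[OF that] f0 by (simp add: Q_ST_def)
  have "((\<lambda>w. w * deriv f w) has_field_derivative deriv f z + z * deriv (deriv f) z) (at z)"
    by (auto intro!: derivative_eq_intros D simp: algebra_simps)
  moreover have "((\<lambda>w. w * deriv f w) has_field_derivative
      deriv (Q_ST f) z * f z + Q_ST f z * deriv f z) (at z)"
    by (rule has_field_derivative_transform_within_open[of "\<lambda>w. Q_ST f w * f w", OF _ open_ball z])
       (auto intro!: derivative_eq_intros D simp: eq)
  ultimately have "deriv f z + z * deriv (deriv f) z = deriv (Q_ST f) z * f z + Q_ST f z * deriv f z"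
    by (rule DERIV_unique)
  then have "Q_CV f z = Q_ST f z + deriv (Q_ST f) z * (f z / deriv f z)"
    using nz'[OF z] by (simp add: Q_CV_def field_simps)
  moreover have "f z / deriv f z = z / Q_ST f z"
    using False nz[OF z False] nz'[OF z] by (simp add: Q_ST_def)
  ultimately show ?thesis by simp
qed

text \<open>With \<open>h = f'' / f'\<close> one has \<open>Q\<^sub>C\<^sub>V = 1 + z h\<close> and \<open>Q\<^sub>S\<^sub>D = z\<^sup>2 h' - (z h)\<^sup>2 / 2\<close>; eliminating \<open>h\<close>
  makes \<open>Q\<^sub>S\<^sub>D\<close> accessible through \<open>Q\<^sub>C\<^sub>V\<close> alone. When \<open>Q\<^sub>C\<^sub>V\<close> is imaginary, the square is real and
  the imaginary part of \<open>Q\<^sub>S\<^sub>D\<close> comes from the derivative only.\<close>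

lemma Q_SD_eq:
  assumes hol: "f holomorphic_on ball 0 1"
    and nz': "\<And>z. z \<in> ball 0 1 \<Longrightarrow> deriv f z \<noteq> 0" and z: "z \<in> ball 0 1"
  shows "Q_SD f z = z * deriv (Q_CV f) z + (1 - (Q_CV f z)\<^sup>2) / 2"
proof -
  define h where "h w = deriv (deriv f) w / deriv f w" for w
  have "h holomorphic_on ball 0 1"
    unfolding h_def using hol nz' by (auto intro!: holomorphic_intros)
  then have [derivative_intros]: "(h has_field_derivative deriv h z) (at z)"
    using holomorphic_derivI open_ball z by blast
  have Q: "Q_CV f = (\<lambda>w. 1 + w * h w)"
    by (simp add: fun_eq_iff Q_CV_def h_def)
  have "((\<lambda>w. 1 + w * h w) has_field_derivative h z + z * deriv h z) (at z)"
    by (auto intro!: derivative_eq_intros simp: algebra_simps)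
  then have "deriv (Q_CV f) z = h z + z * deriv h z"
    unfolding Q by (rule DERIV_imp_deriv)
  moreover have "Q_SD f z = z\<^sup>2 * (deriv h z - 1 / 2 * (h z)\<^sup>2)"
    by (simp add: Q_SD_def schwarzian_def h_def[abs_def])
  ultimately show ?thesis
    by (simp add: Q power2_eq_square field_simps)
qed

text \<open>The derivative of \<open>p + z p' / p\<close>, grouped so that only \<open>z p'\<close>, \<open>z p' + z\<^sup>2 p''\<close> and \<open>p\<close> itself
  occur: these are the quantities controlled at the zero of \<open>Re p\<close> of least modulus.\<close>

lemma z_deriv_Q_CV:
  assumes A: "f \<in> class_A" and nz: "\<And>z. z \<in> ball 0 1 \<Longrightarrow> z \<noteq> 0 \<Longrightarrow> f z \<noteq> 0"
    and nz': "\<And>z. z \<in> ball 0 1 \<Longrightarrow> deriv f z \<noteq> 0" and z: "z \<in> ball 0 1"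
    and pz: "Q_ST f z \<noteq> 0"
  defines "p \<equiv> Q_ST f"
  shows "z * deriv (Q_CV f) z = z * deriv p z
    + (z * deriv p z + z\<^sup>2 * deriv (deriv p) z) / p z - (z * deriv p z / p z)\<^sup>2"
proof -
  have hol: "p holomorphic_on ball 0 1"
    unfolding p_def using A nz by (rule Q_ST_holomorphic)
  note D = holomorphic_derivI[OF hol open_ball z]
    holomorphic_derivI[OF holomorphic_deriv[OF hol open_ball] open_ball z]
  have "((\<lambda>w. p w + w * deriv p w / p w) has_field_derivative
     deriv p z + ((deriv p z + z * deriv (deriv p) z) * p z - z * deriv p z * deriv p z)
       / (p z * p z)) (at z)"
    using pz unfolding p_def[symmetric]
    by (auto intro!: derivative_eq_intros D simp: algebra_simps)
  then have "(Q_CV f has_field_derivative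
     deriv p z + ((deriv p z + z * deriv (deriv p) z) * p z - z * deriv p z * deriv p z)
       / (p z * p z)) (at z)"
    by (rule has_field_derivative_transform_within_open[OF _ open_ball z])
       (use Q_CV_eq[OF A nz nz'] in \<open>simp add: p_def\<close>)
  then have eq: "deriv (Q_CV f) z = deriv p z
      + ((deriv p z + z * deriv (deriv p) z) * p z - z * deriv p z * deriv p z) / (p z * p z)"
    by (rule DERIV_imp_deriv)
  have "p z \<noteq> 0"
    using pz by (simp add: p_def)
  then show ?thesis
    unfolding eq by (simp add: field_simps power2_eq_square)
qed

section \<open>Starlikeness\<close>

text \<open>What all four inequalities have to exclude. At the zero of \<open>Re p\<close>
  of least modulus, with
  \<open>\<sigma> = z p'(z)\<close>, one has \<open>\<rho> \<tau> = \<rho>\<^sup>2 - \<sigma>\<close> and \<open>\<rho> Im Q\<^sub>S\<^sub>D = - Re (z p' + z\<^sup>2 p'')\<close>.\<close>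

lemma boundary_values_if_not_starlike:
  assumes A: "f \<in> class_A" and fq: "\<And>z. z \<in> ball 0 1 \<Longrightarrow> f_deriv_quot f z \<noteq> 0"
    and not_starlike: "\<not> starlike_fun f"
  obtains z and \<rho> \<tau> :: real where "z \<in> ball 0 1"
    "Q_ST f z = \<i> * of_real \<rho>" "Q_CV f z = \<i> * of_real \<tau>"
    "\<rho> * \<tau> > 0" "\<rho> * Im (Q_SD f z) \<ge> 0"
proof -
  have hol: "f holomorphic_on ball 0 1" and f0: "deriv f 0 = 1"
    using A by (auto simp: class_A_def intro: analytic_imp_holomorphic)
  have nz: "f z \<noteq> 0" if "z \<in> ball 0 1" "z \<noteq> 0" for z
    using fq[of z] that by (auto simp: f_deriv_quot_def)
  have nz': "deriv f z \<noteq> 0" if "z \<in> ball 0 1" for z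
    using fq[of z] that f0 by (cases "z = 0") (auto simp: f_deriv_quot_def)
  define p where "p = Q_ST f"
  have phol: "p holomorphic_on ball 0 1"
    unfolding p_def by (rule Q_ST_holomorphic[OF A nz])
  have p0: "Re (p 0) > 0"
    by (simp add: p_def Q_ST_def)
  obtain z1 where z1: "z1 \<in> ball 0 1" "Re (p z1) \<le> 0"
    using not_starlike A unfolding starlike_fun_def p_def by (meson not_le)
  obtain z where z: "z \<in> ball 0 1" "z \<noteq> 0" "Re (p z) = 0"
    "Im (z * deriv p z) = 0" "Re (z * deriv p z) \<le> 0"
    "Re (z * deriv p z + z\<^sup>2 * deriv (deriv p) z) \<le> 0"
    using derivatives_at_least_modulus_zero_of_Re[OF phol p0 z1] by metis
  define \<rho> \<sigma> \<tau> where "\<rho> = Im (p z)" and "\<sigma> = Re (z * deriv p z)" and "\<tau> = \<rho> - \<sigma> / \<rho>"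
  define M where "M = z * deriv p z + z\<^sup>2 * deriv (deriv p) z"
  have p: "p z = \<i> * of_real \<rho>" and s: "z * deriv p z = of_real \<sigma>"
    using z(3,4) by (simp_all add: complex_eq_iff \<rho>_def \<sigma>_def)
  have pz: "p z \<noteq> 0"
    using nz[OF z(1,2)] nz'[OF z(1)] z(2) by (simp add: p_def Q_ST_def)
  then have \<rho>: "\<rho> \<noteq> 0"
    using p by auto
  have CV: "Q_CV f z = \<i> * of_real \<tau>"
  proof -
    have "of_real \<sigma> / (\<i> * of_real \<rho>) = - (\<i> * of_real (\<sigma> / \<rho>))"
      using \<rho> by (simp add: field_simps)
    then show ?thesis
      using Q_CV_eq[OF A nz nz' z(1)] unfolding p_def[symmetric] p s
      by (simp add: \<tau>_def algebra_simps)
  qed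
  have "\<rho> * \<tau> = \<rho> * \<rho> - \<sigma>"
    using \<rho> by (simp add: \<tau>_def field_simps)
  moreover have "\<rho> * \<rho> > 0" "\<sigma> \<le> 0"
    using \<rho> z(5) by (auto simp: \<sigma>_def zero_less_mult_iff)
  ultimately have pos: "\<rho> * \<tau> > 0"
    by linarith
  have "z * deriv (Q_CV f) z = of_real \<sigma> + M / (\<i> * of_real \<rho>) - (of_real \<sigma> / (\<i> * of_real \<rho>))\<^sup>2"
    using z_deriv_Q_CV[OF A nz nz' z(1)] pz unfolding p_def[symmetric] p s M_def[symmetric]
    by (simp add: M_def s)
  moreover have "M / (\<i> * of_real \<rho>) = - (\<i> * M / of_real \<rho>)"
    using \<rho> by (simp add: field_simps)
  moreover have "(of_real \<sigma> / (\<i> * of_real \<rho>))\<^sup>2 = - (of_real (\<sigma>\<^sup>2 / \<rho>\<^sup>2) :: complex)"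
    by (simp add: power_mult_distrib power_divide)
  moreover have "Q_SD f z = z * deriv (Q_CV f) z + (1 - (Q_CV f z)\<^sup>2) / 2"
    using Q_SD_eq hol nz' z(1) by blast
  ultimately have "Q_SD f z = of_real (\<sigma> + \<sigma>\<^sup>2 / \<rho>\<^sup>2 + (1 + \<tau>\<^sup>2) / 2) - \<i> * M / of_real \<rho>"
    by (simp add: CV power_mult_distrib)
  then have "Im (Q_SD f z) = - Re M / \<rho>"
    by (simp only: minus_complex.sel Im_complex_of_real Im_divide_of_real) simp
  then have "\<rho> * Im (Q_SD f z) \<ge> 0"
    using z(6) \<rho> by (simp add: M_def)
  then show ?thesis
    using that[OF z(1) p[unfolded p_def] CV pos] by blast
qed

text \<open>One computation for all four inequalities: \<open>\<kappa>\<close> is the imaginary part of the denominator and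
  \<open>\<mu>\<close> that of the quantity in the second summand.\<close>

lemma Re_nonpos_on_imaginary_axis:
  fixes \<alpha> \<beta> \<kappa> \<mu> :: real
  assumes "\<alpha> \<le> 0" "\<beta> \<ge> 0" "\<kappa> * Im S \<ge> 0"
  shows "Re (of_real \<alpha> * (S / (\<i> * of_real \<kappa>)) + \<i> * of_real \<mu> * (1 + of_real \<beta> * (\<i> * of_real \<mu>))) \<le> 0"
proof -
  have "Re (S / (\<i> * of_real \<kappa>)) = Im S / \<kappa>"
    by (cases "\<kappa> = 0") (simp_all add: Re_divide power2_eq_square field_simps)
  moreover have "0 \<le> Im S / \<kappa>"
    using assms(3) by (auto simp: zero_le_divide_iff zero_le_mult_iff)
  ultimately have "\<alpha> * Re (S / (\<i> * of_real \<kappa>)) \<le> 0"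
    using assms(1) by (metis mult_nonpos_nonneg)
  moreover have "Re (\<i> * of_real \<mu> * (1 + of_real \<beta> * (\<i> * of_real \<mu>))) = - (\<beta> * (\<mu> * \<mu>))"
    by (simp add: algebra_simps)
  moreover have "0 \<le> \<beta> * (\<mu> * \<mu>)"
    using assms(2) by simp
  moreover have "Re (of_real \<alpha> * (S / (\<i> * of_real \<kappa>))) = \<alpha> * Re (S / (\<i> * of_real \<kappa>))"
    by (simp del: times_divide_eq_right)
  ultimately show ?thesis
    by (simp only: plus_complex.sel)
qed

theorem theorem2p16:
  fixes \<alpha> \<beta> :: real and f :: "complex \<Rightarrow> complex"
  assumes "\<alpha> \<le> 0" and "\<beta> \<ge> 0"
    and "f \<in> class_A"
    and "\<forall>z\<in>ball 0 1. f_deriv_quot f z \<noteq> 0"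
    and "(\<forall>z\<in>ball 0 1. Q_ST f z \<noteq> 0 \<and>
            Re (of_real \<alpha> * (Q_SD f z / Q_ST f z) + Q_ST f z * (1 + of_real \<beta> * Q_ST f z)) > 0)
       \<or> (\<forall>z\<in>ball 0 1. Q_CV f z \<noteq> 0 \<and>
            Re (of_real \<alpha> * (Q_SD f z / Q_CV f z) + Q_ST f z * (1 + of_real \<beta> * Q_ST f z)) > 0)
       \<or> (\<forall>z\<in>ball 0 1. Q_CV f z \<noteq> 0 \<and>
            Re (of_real \<alpha> * (Q_SD f z / Q_CV f z) + Q_CV f z * (1 + of_real \<beta> * Q_CV f z)) > 0)
       \<or> (\<forall>z\<in>ball 0 1. Q_ST f z \<noteq> 0 \<and>
            Re (of_real \<alpha> * (Q_SD f z / Q_ST f z) + Q_CV f z * (1 + of_real \<beta> * Q_CV f z)) > 0)"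
  shows "starlike_fun f"
proof (rule ccontr)
  assume "\<not> starlike_fun f"
  then obtain z and \<rho> \<tau> :: real where z: "z \<in> ball 0 1"
    and ST: "Q_ST f z = \<i> * of_real \<rho>" and CV: "Q_CV f z = \<i> * of_real \<tau>"
    and pos: "\<rho> * \<tau> > 0" and SD: "\<rho> * Im (Q_SD f z) \<ge> 0"
    using boundary_values_if_not_starlike assms(3,4) by metis
  have SD': "\<tau> * Im (Q_SD f z) \<ge> 0"
    using pos SD by (auto simp: zero_less_mult_iff zero_le_mult_iff)
  note nonpos = Re_nonpos_on_imaginary_axis[OF assms(1,2) SD]
    Re_nonpos_on_imaginary_axis[OF assms(1,2) SD']
  show False
    using assms(5) z nonpos[of \<rho>] nonpos[of \<tau>] unfolding ST[symmetric] CV[symmetric]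
    by (meson not_le)
qed

end
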